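(* Let $V=\bigotimes_{i=1}^n V_i$ with $V_i$ a complex Hilbert space of dimension $d_i$. Two Hermitian matrices in $\mathrm{End}(V)$ are in the same $\mathrm{GL}_{\mathbf d}$ orbit if and only if they are in the same $\mathrm{U}_{\mathbf d}$ orbit.
   Context: $\mathbf d=(d_1,\dots,d_n)$ is a tuple of positive integers. $\mathrm{GL}_{\mathbf d}=\times_{i=1}^n \mathrm{GL}(\mathbb C^{d_i})$ and $\mathrm{U}_{\mathbf d}=\times_{i=1}^n \mathrm{U}(\mathbb C^{d_i})$ (general linear and unitary groups of $V_i\cong\mathbb C^{d_i}$). Both act on $\mathrm{End}(V)=\bigotimes_{i=1}^n\mathrm{End}(V_i)$ by $(g_1,\dots,g_n).M=(\bigotimes_i g_i)\,M\,(\bigotimes_i g_i)^{-1}$, i.e. by linear extension of $(g_1,\dots,g_n).\bigotimes_i M_i=\bigotimes_i g_iM_ig_i^{-1}$. *)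

theory Defs
  imports
    "Jordan_Normal_Form.Schur_Decomposition"
    "HOL-Algebra.Group_Action"
    "HOL-Algebra.Product_Groups"
begin

definition hermitian_mat :: "complex mat \<Rightarrow> bool"
  where "hermitian_mat A \<longleftrightarrow> mat_adjoint A = A"

definition GL_group :: "nat \<Rightarrow> complex mat monoid"
  where "GL_group m = units_of (ring_mat TYPE(complex) m ())"

definition U_group :: "nat \<Rightarrow> complex mat monoid"
  where "U_group m =
    GL_group m \<lparr>carrier := {u \<in> carrier (GL_group m). mat_adjoint u * u = 1\<^sub>m m}\<rparr>"

text \<open>The factors are numbered \<open>0, \<dots>, n - 1\<close>; only the values of \<open>d\<close> below \<open>n\<close> matter.\<close>

definition GL_tuple :: "nat \<Rightarrow> (nat \<Rightarrow> nat) \<Rightarrow> (nat \<Rightarrow> complex mat) monoid"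
  where "GL_tuple n d = product_group {..<n} (\<lambda>i. GL_group (d i))"

definition U_tuple :: "nat \<Rightarrow> (nat \<Rightarrow> nat) \<Rightarrow> (nat \<Rightarrow> complex mat) monoid"
  where "U_tuple n d = product_group {..<n} (\<lambda>i. U_group (d i))"

text \<open>The Kronecker product is the matrix of \<open>A \<otimes> B\<close> in the lexicographically ordered basis
  \<open>e\<^sub>i \<otimes> e\<^sub>j\<close>; this basis is orthonormal for the tensor product inner product, so the adjoint
  on \<open>End(V)\<close> is \<^const>\<open>mat_adjoint\<close>.\<close>

definition kronecker :: "complex mat \<Rightarrow> complex mat \<Rightarrow> complex mat"
  where "kronecker A B =
    mat (dim_row A * dim_row B) (dim_col A * dim_col B)
      (\<lambda>(i, j). A $$ (i div dim_row B, j div dim_col B) * B $$ (i mod dim_row B, j mod dim_col B))"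

primrec tensor :: "nat \<Rightarrow> (nat \<Rightarrow> complex mat) \<Rightarrow> complex mat"
  where
    "tensor 0 g = 1\<^sub>m 1"
  | "tensor (Suc n) g = kronecker (tensor n g) (g n)"

definition tensor_dim :: "nat \<Rightarrow> (nat \<Rightarrow> nat) \<Rightarrow> nat"
  where "tensor_dim n d = (\<Prod>i<n. d i)"

definition End_tensor :: "nat \<Rightarrow> (nat \<Rightarrow> nat) \<Rightarrow> complex mat set"
  where "End_tensor n d = carrier_mat (tensor_dim n d) (tensor_dim n d)"

text \<open>The map is restricted to \<^const>\<open>End_tensor\<close> because \<^locale>\<open>group_action\<close> asks for
  extensional bijections.\<close>

definition conj_action ::
  "nat \<Rightarrow> (nat \<Rightarrow> nat) \<Rightarrow> (nat \<Rightarrow> complex mat) \<Rightarrow> complex mat \<Rightarrow> complex mat"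
  where "conj_action n d g =
    (\<lambda>M \<in> End_tensor n d.
      tensor n g * M * inv\<^bsub>ring_mat TYPE(complex) (tensor_dim n d) ()\<^esub> (tensor n g))"

lemma group_GL_group: "group (GL_group m)"
  unfolding GL_group_def
  by (intro monoid.units_group ring.is_monoid ring_mat)

lemma carrier_GL_group:
  "carrier (GL_group m) = Units (ring_mat TYPE(complex) m ())"
  by (simp add: GL_group_def units_of_def)

lemma mult_GL_group [simp]: "x \<otimes>\<^bsub>GL_group m\<^esub> y = x * y"
  by (simp add: GL_group_def units_of_def ring_mat_def)

lemma one_GL_group [simp]: "\<one>\<^bsub>GL_group m\<^esub> = 1\<^sub>m m"
  by (simp add: GL_group_def units_of_def ring_mat_def)

lemma GL_group_carrier_mat: "x \<in> carrier (GL_group m) \<Longrightarrow> x \<in> carrier_mat m m"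
  by (auto simp: carrier_GL_group Units_def ring_mat_def)

lemma mat_adjoint_dim [simp]:
  "dim_row (mat_adjoint A) = dim_col A" "dim_col (mat_adjoint A) = dim_row A"
  by (auto simp: mat_adjoint_def)

lemma mat_adjoint_index:
  fixes A :: "complex mat"
  assumes "i < dim_col A" "j < dim_row A"
  shows "mat_adjoint A $$ (i, j) = cnj (A $$ (j, i))"
  using assms by (simp add: mat_adjoint_def mat_of_rows_index)

lemma mat_adjoint_carrier:
  "A \<in> carrier_mat m k \<Longrightarrow> mat_adjoint A \<in> carrier_mat k m"
  by auto

lemma mat_adjoint_mult:
  fixes A B :: "complex mat"
  assumes A: "A \<in> carrier_mat a b" and B: "B \<in> carrier_mat b c"
  shows "mat_adjoint (A * B) = mat_adjoint B * mat_adjoint A"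
proof (rule eq_matI)
  fix i j assume "i < dim_row (mat_adjoint B * mat_adjoint A)"
    "j < dim_col (mat_adjoint B * mat_adjoint A)"
  then have ij: "i < c" "j < a" using A B by auto
  show "mat_adjoint (A * B) $$ (i, j) = (mat_adjoint B * mat_adjoint A) $$ (i, j)"
    using A B ij
    by (auto simp: mat_adjoint_index scalar_prod_def mult.commute intro!: sum.cong)
qed (use A B in auto)

lemma mat_adjoint_one [simp]: "mat_adjoint (1\<^sub>m m :: complex mat) = 1\<^sub>m m"
  by (rule eq_matI) (auto simp: mat_adjoint_index)

lemma U_group_subgroup: "subgroup (carrier (U_group m)) (GL_group m)"
proof -
  interpret group "GL_group m" by (rule group_GL_group)
  show ?thesis
  proof (rule subgroupI)
    show "carrier (U_group m) \<subseteq> carrier (GL_group m)"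
      by (auto simp: U_group_def)
    have "1\<^sub>m m \<in> carrier (U_group m)"
      using one_closed by (simp add: U_group_def)
    then show "carrier (U_group m) \<noteq> {}" by auto
  next
    fix a assume a: "a \<in> carrier (U_group m)"
    let ?b = "inv\<^bsub>GL_group m\<^esub> a"
    from a have aG: "a \<in> carrier (GL_group m)" and aa: "mat_adjoint a * a = 1\<^sub>m m"
      by (auto simp: U_group_def)
    have bG: "?b \<in> carrier (GL_group m)" using aG by simp
    have am: "a \<in> carrier_mat m m" and bm: "?b \<in> carrier_mat m m"
      using aG bG GL_group_carrier_mat by auto
    have ab: "a * ?b = 1\<^sub>m m" using r_inv[OF aG] by simp
    have "mat_adjoint a = mat_adjoint a * (a * ?b)"
      using ab right_mult_one_mat[OF mat_adjoint_carrier[OF am]] by simp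
    also have "\<dots> = mat_adjoint a * a * ?b"
      using am bm mat_adjoint_carrier[OF am] by (simp add: assoc_mult_mat[of _ m m _ m _ m])
    finally have b: "?b = mat_adjoint a" using aa bm by simp
    have "mat_adjoint ?b * ?b = mat_adjoint ?b * mat_adjoint a" using b by simp
    also have "\<dots> = mat_adjoint (a * ?b)" using mat_adjoint_mult[OF am bm] by simp
    finally show "?b \<in> carrier (U_group m)" using ab bG by (simp add: U_group_def)
  next
    fix a b assume "a \<in> carrier (U_group m)" "b \<in> carrier (U_group m)"
    then have G: "a \<in> carrier (GL_group m)" "b \<in> carrier (GL_group m)"
      and u: "mat_adjoint a * a = 1\<^sub>m m" "mat_adjoint b * b = 1\<^sub>m m"
      by (auto simp: U_group_def)
    have am: "a \<in> carrier_mat m m" and bm: "b \<in> carrier_mat m m"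
      using G GL_group_carrier_mat by auto
    note adj = mat_adjoint_carrier[OF am] mat_adjoint_carrier[OF bm]
    have "mat_adjoint (a * b) * (a * b) = mat_adjoint b * (mat_adjoint a * a) * b"
      using am bm adj
      by (simp add: mat_adjoint_mult[OF am bm] assoc_mult_mat[of _ m m _ m _ m])
    also have "\<dots> = 1\<^sub>m m" using u adj bm by simp
    finally show "a \<otimes>\<^bsub>GL_group m\<^esub> b \<in> carrier (U_group m)"
      using m_closed[OF G] by (simp add: U_group_def)
  qed
qed

lemma group_U_group: "group (U_group m)"
  using subgroup.subgroup_is_group[OF U_group_subgroup group_GL_group, of m]
  by (simp add: U_group_def)

lemma group_GL_tuple: "group (GL_tuple n d)"
  by (simp add: GL_tuple_def group_GL_group)

lemma group_U_tuple: "group (U_tuple n d)"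
  by (simp add: U_tuple_def group_U_group)

lemma U_tuple_eq: "U_tuple n d = GL_tuple n d \<lparr>carrier := carrier (U_tuple n d)\<rparr>"
  by (simp add: U_tuple_def GL_tuple_def product_group_def U_group_def)

lemma U_tuple_subgroup: "subgroup (carrier (U_tuple n d)) (GL_tuple n d)"
  by (simp add: U_tuple_def GL_tuple_def PiE_subgroup_product_group group_GL_group
      U_group_subgroup)

lemma kronecker_carrier:
  "A \<in> carrier_mat a b \<Longrightarrow> B \<in> carrier_mat c e \<Longrightarrow>
    kronecker A B \<in> carrier_mat (a * c) (b * e)"
  by (auto simp: kronecker_def)

lemma sum_div_mod:
  fixes f g :: "nat \<Rightarrow> 'a :: comm_semiring_1"
  shows "(\<Sum>k<a * b. f (k div b) * g (k mod b)) = (\<Sum>i<a. f i) * (\<Sum>j<b. g j)"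
proof (cases "b = 0")
  case False
  have "(\<Sum>k<a * b. f (k div b) * g (k mod b)) = (\<Sum>(i, j)\<in>{..<a} \<times> {..<b}. f i * g j)"
  proof (rule sum.reindex_bij_witness[where i = "\<lambda>(i, j). i * b + j" and j = "\<lambda>k. (k div b, k mod b)"])
    fix p assume p: "p \<in> {..<a} \<times> {..<b}"
    then obtain i j where [simp]: "p = (i, j)" and ij: "i < a" "j < b" by auto
    have "i * b + j < Suc i * b" using ij by simp
    also have "\<dots> \<le> a * b" using ij by (intro mult_right_mono) auto
    finally show "(case p of (i, j) \<Rightarrow> i * b + j) \<in> {..<a * b}" by simp
  qed (use False in \<open>auto simp: less_mult_imp_div_less\<close>)
  then show ?thesis by (simp add: sum_product sum.cartesian_product)
qed auto

lemma kronecker_mult: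
  assumes "A \<in> carrier_mat a1 a2" "B \<in> carrier_mat b1 b2"
    and "C \<in> carrier_mat a2 a3" "E \<in> carrier_mat b2 b3"
  shows "kronecker A B * kronecker C E = kronecker (A * C) (B * E)"
proof (rule eq_matI)
  fix i j
  assume "i < dim_row (kronecker (A * C) (B * E))" "j < dim_col (kronecker (A * C) (B * E))"
  then have ij: "i < a1 * b1" "j < a3 * b3" using assms by (auto simp: kronecker_def)
  then have pos: "b1 > 0" "b3 > 0" by (auto intro!: Nat.gr0I)
  have dm: "i div b1 < a1" "i mod b1 < b1" "j div b3 < a3" "j mod b3 < b3"
    using ij pos by (auto simp: less_mult_imp_div_less)
  have "(kronecker A B * kronecker C E) $$ (i, j) =
      (\<Sum>k<a2 * b2. (A $$ (i div b1, k div b2) * B $$ (i mod b1, k mod b2)) *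
        (C $$ (k div b2, j div b3) * E $$ (k mod b2, j mod b3)))"
    using assms ij by (auto simp: kronecker_def scalar_prod_def atLeast0LessThan)
  also have "\<dots> = (\<Sum>k<a2 * b2. (A $$ (i div b1, k div b2) * C $$ (k div b2, j div b3)) *
        (B $$ (i mod b1, k mod b2) * E $$ (k mod b2, j mod b3)))"
    by (simp add: mult_ac)
  also have "\<dots> = (\<Sum>k<a2. A $$ (i div b1, k) * C $$ (k, j div b3)) *
        (\<Sum>k<b2. B $$ (i mod b1, k) * E $$ (k, j mod b3))"
    by (rule sum_div_mod)
  also have "\<dots> = kronecker (A * C) (B * E) $$ (i, j)"
    using assms ij dm by (auto simp: kronecker_def scalar_prod_def atLeast0LessThan)
  finally show "(kronecker A B * kronecker C E) $$ (i, j) =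
      kronecker (A * C) (B * E) $$ (i, j)" .
qed (use assms in \<open>auto simp: kronecker_def\<close>)

lemma kronecker_one: "kronecker (1\<^sub>m a) (1\<^sub>m b) = 1\<^sub>m (a * b)"
proof (rule eq_matI)
  fix i j assume "i < dim_row (1\<^sub>m (a * b) :: complex mat)" "j < dim_col (1\<^sub>m (a * b) :: complex mat)"
  then have ij: "i < a * b" "j < a * b" by auto
  then have "b > 0" by (auto intro!: Nat.gr0I)
  moreover have "i = j" if "i div b = j div b" "i mod b = j mod b"
    using that by (metis div_mult_mod_eq)
  ultimately show "kronecker (1\<^sub>m a) (1\<^sub>m b) $$ (i, j) = 1\<^sub>m (a * b) $$ (i, j)"
    using ij by (auto simp: kronecker_def less_mult_imp_div_less)
qed (auto simp: kronecker_def)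

lemma tensor_carrier:
  assumes "\<And>i. i < n \<Longrightarrow> g i \<in> carrier_mat (d i) (d i)"
  shows "tensor n g \<in> carrier_mat (tensor_dim n d) (tensor_dim n d)"
  using assms by (induction n) (auto simp: tensor_dim_def intro: kronecker_carrier)

lemma tensor_mult:
  assumes "\<And>i. i < n \<Longrightarrow> g i \<in> carrier_mat (d i) (d i)"
    and "\<And>i. i < n \<Longrightarrow> h i \<in> carrier_mat (d i) (d i)"
  shows "tensor n g * tensor n h = tensor n (\<lambda>i. g i * h i)"
  using assms
proof (induction n)
  case (Suc n)
  have "kronecker (tensor n g) (g n) * kronecker (tensor n h) (h n) =
      kronecker (tensor n g * tensor n h) (g n * h n)"
    using Suc.prems
    by (intro kronecker_mult[OF tensor_carrier[of n g d] _ tensor_carrier[of n h d],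
          of "g n" "d n" "d n" "h n" "d n"]) auto
  then show ?case
    using Suc by simp
qed simp

lemma tensor_one: "tensor n (\<lambda>i. 1\<^sub>m (d i)) = 1\<^sub>m (tensor_dim n d)"
  by (induction n) (auto simp: tensor_dim_def kronecker_one)

lemma tensor_cong:
  assumes "\<And>i. i < n \<Longrightarrow> g i = h i"
  shows "tensor n g = tensor n h"
  using assms by (induction n) auto

lemma tensor_hom: "tensor n \<in> hom (GL_tuple n d) (GL_group (tensor_dim n d))"
proof -
  interpret G: group "GL_tuple n d" by (rule group_GL_tuple)
  let ?R = "ring_mat TYPE(complex) (tensor_dim n d) ()"
  have cm: "g i \<in> carrier_mat (d i) (d i)" if "g \<in> carrier (GL_tuple n d)" "i < n" for g i
    using that GL_group_carrier_mat by (auto simp: GL_tuple_def)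
  have tc: "tensor n g \<in> carrier_mat (tensor_dim n d) (tensor_dim n d)"
    if "g \<in> carrier (GL_tuple n d)" for g
    using that cm by (intro tensor_carrier) auto
  have mult: "tensor n (g \<otimes>\<^bsub>GL_tuple n d\<^esub> h) = tensor n g * tensor n h"
    if "g \<in> carrier (GL_tuple n d)" "h \<in> carrier (GL_tuple n d)" for g h
  proof -
    have "tensor n (g \<otimes>\<^bsub>GL_tuple n d\<^esub> h) = tensor n (\<lambda>i. g i * h i)"
      by (rule tensor_cong) (simp add: GL_tuple_def)
    then show ?thesis using tensor_mult[of n g d h] that cm by simp
  qed
  have one: "tensor n \<one>\<^bsub>GL_tuple n d\<^esub> = 1\<^sub>m (tensor_dim n d)"
    unfolding tensor_one[symmetric]
    by (rule tensor_cong) (simp add: GL_tuple_def)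
  show ?thesis
  proof (rule homI)
    fix g assume g: "g \<in> carrier (GL_tuple n d)"
    let ?h = "inv\<^bsub>GL_tuple n d\<^esub> g"
    have h: "?h \<in> carrier (GL_tuple n d)" using g by simp
    have "tensor n g * tensor n ?h = 1\<^sub>m (tensor_dim n d)"
      "tensor n ?h * tensor n g = 1\<^sub>m (tensor_dim n d)"
      using mult[OF g h] mult[OF h g] one g by simp_all
    then show "tensor n g \<in> carrier (GL_group (tensor_dim n d))"
      using tc[OF g] tc[OF h] by (auto simp: carrier_GL_group Units_def ring_mat_def)
  qed (use mult in simp)
qed

lemma conj_action_group_action: "group_action (GL_tuple n d) (End_tensor n d) (conj_action n d)"
proof -
  let ?N = "tensor_dim n d"
  let ?R = "ring_mat TYPE(complex) ?N ()"
  let ?T = "tensor n"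
  interpret G: group "GL_tuple n d" by (rule group_GL_tuple)
  interpret H: group "GL_group ?N" by (rule group_GL_group)
  interpret R: ring ?R by (rule ring_mat)
  interpret h: group_hom "GL_tuple n d" "GL_group ?N" ?T
    by unfold_locales (rule tensor_hom)
  have inv: "inv\<^bsub>?R\<^esub> x = inv\<^bsub>GL_group ?N\<^esub> x" if "x \<in> carrier (GL_group ?N)" for x
    using that R.units_of_inv by (simp add: GL_group_def units_of_carrier)
  have act: "conj_action n d g M = ?T g * M * ?T (inv\<^bsub>GL_tuple n d\<^esub> g)"
    if "g \<in> carrier (GL_tuple n d)" "M \<in> carrier_mat ?N ?N" for g M
    using that inv[of "?T g"] by (simp add: conj_action_def End_tensor_def)
  have tc: "?T g \<in> carrier_mat ?N ?N" if "g \<in> carrier (GL_tuple n d)" for g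
    using that GL_group_carrier_mat by simp
  have cl: "conj_action n d g M \<in> carrier_mat ?N ?N"
    if "g \<in> carrier (GL_tuple n d)" "M \<in> carrier_mat ?N ?N" for g M
    using that act tc[of g] tc[of "inv\<^bsub>GL_tuple n d\<^esub> g"] by simp
  have comp: "conj_action n d (g \<otimes>\<^bsub>GL_tuple n d\<^esub> k) M = conj_action n d g (conj_action n d k M)"
    if g: "g \<in> carrier (GL_tuple n d)" and k: "k \<in> carrier (GL_tuple n d)"
      and M: "M \<in> carrier_mat ?N ?N" for g k M
  proof -
    let ?g = "inv\<^bsub>GL_tuple n d\<^esub> g" and ?k = "inv\<^bsub>GL_tuple n d\<^esub> k"
    have gi: "?g \<in> carrier (GL_tuple n d)" and ki: "?k \<in> carrier (GL_tuple n d)"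
      using g k by auto
    have "conj_action n d (g \<otimes>\<^bsub>GL_tuple n d\<^esub> k) M = ?T g * ?T k * M * (?T ?k * ?T ?g)"
      using act[OF G.m_closed[OF g k] M] h.hom_mult[OF g k] h.hom_mult[OF ki gi]
        G.inv_mult_group[OF g k] by simp
    also have "\<dots> = ?T g * (?T k * M * ?T ?k) * ?T ?g"
      using tc[OF g] tc[OF k] tc[OF gi] tc[OF ki] M
      by (simp add: assoc_mult_mat[of _ ?N ?N _ ?N _ ?N])
    also have "\<dots> = conj_action n d g (conj_action n d k M)"
      using act[OF k M] act[OF g cl[OF k M]] by simp
    finally show ?thesis .
  qed
  have one: "conj_action n d \<one>\<^bsub>GL_tuple n d\<^esub> M = M" if "M \<in> carrier_mat ?N ?N" for M
    using act[OF G.one_closed that] that h.hom_one by simp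
  have bij: "conj_action n d g \<in> Bij (End_tensor n d)" if g: "g \<in> carrier (GL_tuple n d)" for g
  proof -
    let ?g = "inv\<^bsub>GL_tuple n d\<^esub> g"
    have gi: "?g \<in> carrier (GL_tuple n d)" using g by simp
    have "bij_betw (conj_action n d g) (End_tensor n d) (End_tensor n d)"
    proof (rule bij_betw_byWitness[where f' = "conj_action n d ?g"])
      show "\<forall>a\<in>End_tensor n d. conj_action n d ?g (conj_action n d g a) = a"
        using comp[OF gi g] one g by (simp add: End_tensor_def)
      show "\<forall>a\<in>End_tensor n d. conj_action n d g (conj_action n d ?g a) = a"
        using comp[OF g gi] one g by (simp add: End_tensor_def)
    qed (use cl[OF g] cl[OF gi] in \<open>auto simp: End_tensor_def\<close>)
    moreover have "conj_action n d g \<in> extensional (End_tensor n d)"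
      by (simp add: conj_action_def)
    ultimately show ?thesis by (simp add: Bij_def)
  qed
  show ?thesis
  proof (intro group_action.intro group_hom.intro group_hom_axioms.intro group_BijGroup group_GL_tuple homI)
    fix g assume "g \<in> carrier (GL_tuple n d)"
    then show "conj_action n d g \<in> carrier (BijGroup (End_tensor n d))"
      using bij by (simp add: BijGroup_def)
  next
    fix g k assume g: "g \<in> carrier (GL_tuple n d)" and k: "k \<in> carrier (GL_tuple n d)"
    have "conj_action n d (g \<otimes>\<^bsub>GL_tuple n d\<^esub> k) =
        compose (End_tensor n d) (conj_action n d g) (conj_action n d k)"
    proof
      fix M show "conj_action n d (g \<otimes>\<^bsub>GL_tuple n d\<^esub> k) M =
        compose (End_tensor n d) (conj_action n d g) (conj_action n d k) M"
      proof (cases "M \<in> End_tensor n d")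
        case True
        then show ?thesis
          using comp[OF g k, of M] by (simp add: compose_def End_tensor_def)
      next
        case False
        then show ?thesis
          unfolding compose_def conj_action_def restrict_def by simp
      qed
    qed
    then show "conj_action n d (g \<otimes>\<^bsub>GL_tuple n d\<^esub> k) =
        conj_action n d g \<otimes>\<^bsub>BijGroup (End_tensor n d)\<^esub> conj_action n d k"
      using bij[OF g] bij[OF k] by (simp add: BijGroup_def)
  qed
qed

lemma conj_action_U_group_action:
  "group_action (U_tuple n d) (End_tensor n d) (conj_action n d)"
  by (subst U_tuple_eq)
    (rule group_action.induced_action[OF conj_action_group_action U_tuple_subgroup])

lemma conj_action_tensor:
  assumes g: "g \<in> carrier (GL_tuple n d)"
    and M: "\<And>i. i < n \<Longrightarrow> M i \<in> carrier_mat (d i) (d i)"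
  shows "conj_action n d g (tensor n M) = tensor n (\<lambda>i. g i * M i * inv\<^bsub>GL_group (d i)\<^esub> (g i))"
proof -
  let ?N = "tensor_dim n d"
  let ?R = "ring_mat TYPE(complex) ?N ()"
  let ?h = "inv\<^bsub>GL_tuple n d\<^esub> g"
  interpret G: group "GL_tuple n d" by (rule group_GL_tuple)
  interpret H: group "GL_group ?N" by (rule group_GL_group)
  interpret R: ring ?R by (rule ring_mat)
  interpret h: group_hom "GL_tuple n d" "GL_group ?N" "tensor n"
    by unfold_locales (rule tensor_hom)
  have h: "?h \<in> carrier (GL_tuple n d)" using g by simp
  have cm: "x i \<in> carrier_mat (d i) (d i)" if "x \<in> carrier (GL_tuple n d)" "i < n" for x i
    using that GL_group_carrier_mat by (auto simp: GL_tuple_def)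
  have hi: "?h i = inv\<^bsub>GL_group (d i)\<^esub> (g i)" if "i < n" for i
    using g that by (simp add: GL_tuple_def group_GL_group)
  have "inv\<^bsub>?R\<^esub> (tensor n g) = inv\<^bsub>GL_group ?N\<^esub> (tensor n g)"
    using h.hom_closed[OF g] R.units_of_inv by (simp add: GL_group_def units_of_carrier)
  then have "conj_action n d g (tensor n M) = tensor n g * tensor n M * tensor n ?h"
    using g tensor_carrier[of n M d] M by (simp add: conj_action_def End_tensor_def)
  also have "tensor n g * tensor n M = tensor n (\<lambda>i. g i * M i)"
    using cm[OF g] M by (rule tensor_mult)
  also have "tensor n (\<lambda>i. g i * M i) * tensor n ?h = tensor n (\<lambda>i. g i * M i * ?h i)"
    using mult_carrier_mat[OF cm[OF g] M] cm[OF h] by (rule tensor_mult)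
  also have "\<dots> = tensor n (\<lambda>i. g i * M i * inv\<^bsub>GL_group (d i)\<^esub> (g i))"
    by (rule tensor_cong) (simp add: hi)
  finally show ?thesis .
qed

end

theory Submission
  imports Defs "Jordan_Normal_Form.Spectral_Radius"
begin

text \<open>
  Only one direction has content, since \<open>U\<^sub>d\<close> is a subgroup of \<open>GL\<^sub>d\<close>. Suppose that
  \<open>T = g\<^sub>0 \<otimes> \<dots> \<otimes> g\<^bsub>n-1\<^esub>\<close> satisfies \<open>T A = B T\<close>, with \<open>A\<close> and \<open>B\<close> Hermitian. The adjoint of
  this equation is \<open>A T* = T* B\<close>, and together they give \<open>A T* T = T* B T = T* T A\<close>: the matrix
  \<open>A\<close> commutes with \<open>T* T\<close>. In the polar decomposition \<open>T = U P\<close> the positive factor \<open>P\<close> is the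
  square root of \<open>T* T\<close>, so \<open>A\<close> commutes with \<open>P\<close> as well, and \<open>U A = T P\<inverse> A = T A P\<inverse> = B T P\<inverse> =
  B U\<close>. Hence the unitary factor \<open>U\<close> already carries \<open>A\<close> to \<open>B\<close>. It remains to see that \<open>U\<close> comes
  from \<open>U\<^sub>d\<close>, and this holds because the polar decomposition of a tensor product is the tensor
  product of the polar decompositions.

  To obtain both facts at once, each \<open>g\<^sub>i* g\<^sub>i\<close> is diagonalized by a unitary \<open>W\<^sub>i\<close> with positive
  eigenvalues (\<open>adjoint_mult_diagonalizable\<close>, from the spectral theorem
  \<open>hermitian_unitarily_diagonalizable\<close>). Replacing each eigenvalue \<open>x\<close> by \<open>1 / sqrt x\<close> gives a
  matrix \<open>q\<^sub>i\<close> with \<open>g\<^sub>i q\<^sub>i\<close> unitary (\<open>polar_decomposition_unitary\<close>). The function \<open>1 / sqrt x\<close> is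
  multiplicative, so the tensor product \<open>Q\<close> of the \<open>q\<^sub>i\<close> is obtained from \<open>T* T\<close> by
  applying the same function to the eigenvalues of \<open>T* T\<close> (\<open>tensor_conjugated_mat_diag\<close>). A
  matrix that commutes with a diagonal matrix preserves its eigenspaces, and therefore commutes
  with any function of it (\<open>commutes_mat_diag\<close>); hence \<open>A\<close> commutes with \<open>Q = P\<inverse>\<close>.
\<close>

section \<open>Adjoints and unitary matrices\<close>

lemma mat_adjoint_mat_adjoint [simp]: "mat_adjoint (mat_adjoint A) = (A :: complex mat)"
  by (rule eq_matI) (auto simp: mat_adjoint_index)

lemma mat_adjoint_mult3:
  fixes A B C :: "complex mat"
  assumes "A \<in> carrier_mat m m" "B \<in> carrier_mat m m" "C \<in> carrier_mat m m"
  shows "mat_adjoint (A * B * C) = mat_adjoint C * mat_adjoint B * mat_adjoint A"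
  using assms
  by (simp add: mat_adjoint_mult[of _ m m _ m] mat_adjoint_carrier assoc_mult_mat[of _ m m _ m _ m])

lemma mat_adjoint_mat_diag:
  "mat_adjoint (mat_diag n f) = mat_diag n (\<lambda>i. cnj (f i))"
  by (rule eq_matI) (auto simp: mat_adjoint_index mat_diag_def)

lemma mat_adjoint_four_block_diag:
  fixes A D :: "complex mat"
  assumes "A \<in> carrier_mat a a" "D \<in> carrier_mat b b"
  shows "mat_adjoint (four_block_mat A (0\<^sub>m a b) (0\<^sub>m b a) D) =
    four_block_mat (mat_adjoint A) (0\<^sub>m a b) (0\<^sub>m b a) (mat_adjoint D)"
  by (rule eq_matI) (use assms in \<open>auto simp: mat_adjoint_index\<close>)

lemma mult_four_block_diag:
  fixes A D :: "complex mat"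
  assumes "A \<in> carrier_mat a a" "D \<in> carrier_mat b b" "A' \<in> carrier_mat a a" "D' \<in> carrier_mat b b"
  shows "four_block_mat A (0\<^sub>m a b) (0\<^sub>m b a) D * four_block_mat A' (0\<^sub>m a b) (0\<^sub>m b a) D' =
    four_block_mat (A * A') (0\<^sub>m a b) (0\<^sub>m b a) (D * D')"
  using assms by (subst mult_four_block_mat[of _ a a _ b _ b]) auto

lemma carrier_GL_group_iff:
  "g \<in> carrier (GL_group m) \<longleftrightarrow>
    g \<in> carrier_mat m m \<and> (\<exists>h \<in> carrier_mat m m. h * g = 1\<^sub>m m \<and> g * h = 1\<^sub>m m)"
  by (auto simp: carrier_GL_group Units_def ring_mat_def)

lemma carrier_U_group_iff:
  "W \<in> carrier (U_group m) \<longleftrightarrow> W \<in> carrier_mat m m \<and> mat_adjoint W * W = 1\<^sub>m m"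
  using mat_mult_left_right_inverse[of "mat_adjoint W" m W]
  by (auto simp: U_group_def carrier_GL_group_iff mat_adjoint_carrier
      intro!: bexI[of _ "mat_adjoint W"])

lemma U_group_mult_adjoint:
  assumes "W \<in> carrier (U_group m)"
  shows "W * mat_adjoint W = 1\<^sub>m m"
  using assms mat_mult_left_right_inverse[of "mat_adjoint W" m W]
  by (auto simp: carrier_U_group_iff mat_adjoint_carrier)

lemma U_group_mult_closed:
  "V \<in> carrier (U_group m) \<Longrightarrow> W \<in> carrier (U_group m) \<Longrightarrow> V * W \<in> carrier (U_group m)"
  using subgroup.m_closed[OF U_group_subgroup] by fastforce

section \<open>The spectral theorem for Hermitian matrices\<close>

text \<open>Complete \<open>v\<close> to a basis and apply Gram-Schmidt, which keeps the first vector. The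
  resulting vectors are orthogonal but not normalized; dividing each by its norm makes the matrix
  unitary and only rescales the first column.\<close>

lemma exists_unitary_with_first_column:
  fixes v :: "complex vec"
  assumes v: "v \<in> carrier_vec n" and v0: "v \<noteq> 0\<^sub>v n"
  shows "\<exists>W \<in> carrier (U_group n). \<exists>c. col W 0 = c \<cdot>\<^sub>v v"
proof -
  interpret cof_vec_space n "TYPE(complex)" .
  have n: "n > 0" using v v0 by (auto intro!: Nat.gr0I)
  define b where "b = basis_completion v"
  define ws where "ws = gram_schmidt n b"
  from basis_completion[OF v v0, folded b_def]
  have dist_b: "distinct b" and indep: "\<not> lin_dep (set b)" and b: "set b \<subseteq> carrier_vec n"
    and hdb: "hd b = v" and len_b: "length b = n" by auto
  from hdb len_b n obtain vs where bv: "b = v # vs" by (cases b) auto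
  from gram_schmidt_result[OF b dist_b indep refl, folded ws_def]
  have ws: "set ws \<subseteq> carrier_vec n" "corthogonal ws" "length ws = n"
    by (auto simp: len_b)
  have "hd ws = v" using gram_schmidt_hd[OF v, of vs, folded bv] unfolding ws_def .
  then have ws0: "ws ! 0 = v" using ws(3) n by (cases ws) auto
  have wsc: "dim_vec (ws ! j) = n" if "j < n" for j
    using ws(1,3) that by (metis carrier_vecD nth_mem subsetD)
  define s where "s j = sqrt (Re (ws ! j \<bullet>c ws ! j))" for j
  have s: "complex_of_real (s j) * of_real (s j) = ws ! j \<bullet>c ws ! j" "s j > 0" if "j < n" for j
  proof -
    have "ws ! j \<bullet>c ws ! j \<noteq> 0" using corthogonalD[OF ws(2), of j j] ws(3) that by simp
    then have "ws ! j \<bullet>c ws ! j > 0"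
      using conjugate_square_ge_0_vec[of "ws ! j"] by (simp add: less_le)
    then have "Re (ws ! j \<bullet>c ws ! j) > 0" "Im (ws ! j \<bullet>c ws ! j) = 0"
      by (auto simp: less_complex_def)
    then show "complex_of_real (s j) * of_real (s j) = ws ! j \<bullet>c ws ! j" "s j > 0"
      by (auto simp: s_def complex_eq_iff simp flip: of_real_mult)
  qed
  define W where "W = mat n n (\<lambda>(i, j). ws ! j $ i / of_real (s j))"
  have W: "W \<in> carrier_mat n n" by (simp add: W_def)
  have "mat_adjoint W * W = 1\<^sub>m n"
  proof (rule eq_matI)
    fix i j assume "i < dim_row (1\<^sub>m n :: complex mat)" "j < dim_col (1\<^sub>m n :: complex mat)"
    then have ij: "i < n" "j < n" by auto
    have "(mat_adjoint W * W) $$ (i, j) =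
        (\<Sum>k<n. ws ! j $ k * cnj (ws ! i $ k) / of_real (s i * s j))"
      using W ij by (auto simp: scalar_prod_def mat_adjoint_index W_def atLeast0LessThan
          intro!: sum.cong)
    also have "\<dots> = (ws ! j \<bullet>c ws ! i) / of_real (s i * s j)"
      using wsc ij by (auto simp: scalar_prod_def sum_divide_distrib atLeast0LessThan
          intro!: sum.cong)
    also have "\<dots> = 1\<^sub>m n $$ (i, j)"
    proof (cases "i = j")
      case True
      then show ?thesis using s[of i] ij by (simp flip: s(1))
    next
      case False
      then show ?thesis using corthogonalD[OF ws(2), of j i] ws(3) ij by simp
    qed
    finally show "(mat_adjoint W * W) $$ (i, j) = 1\<^sub>m n $$ (i, j)" .
  qed (use W in auto)
  moreover have "col W 0 = (1 / of_real (s 0)) \<cdot>\<^sub>v v"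
    by (rule eq_vecI) (use W n v ws0 in \<open>auto simp: W_def\<close>)
  ultimately show ?thesis using W by (auto simp: carrier_U_group_iff)
qed

text \<open>Induction on the size. A unitary matrix whose first column is an eigenvector of \<open>H\<close> turns
  the first column of \<open>H\<close> into \<open>(e, 0, \<dots>, 0)\<close>. Because the result is Hermitian, its first row has
  the same shape, so it splits into a \<open>1 \<times> 1\<close> block and a smaller Hermitian block.\<close>

lemma hermitian_unitarily_diagonalizable:
  assumes "H \<in> carrier_mat n n" "hermitian_mat H"
  shows "\<exists>W \<in> carrier (U_group n). \<exists>a. mat_adjoint W * H * W = mat_diag n a"
  using assms
proof (induction n arbitrary: H)
  case 0
  show ?case
    by (intro bexI[of _ "1\<^sub>m 0"] exI[of _ "\<lambda>_. 0"] eq_matI)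
      (use 0 in \<open>auto simp: carrier_U_group_iff mat_diag_def\<close>)
next
  case (Suc n)
  let ?m = "Suc n"
  note H = Suc.prems(1)
  obtain v e where "eigenvector H v e"
    using spectrum_non_empty[OF H] by (auto simp: spectrum_def eigenvalue_def)
  then have v: "v \<in> carrier_vec ?m" "v \<noteq> 0\<^sub>v ?m" and ev: "H *\<^sub>v v = e \<cdot>\<^sub>v v"
    using H by (auto simp: eigenvector_def)
  obtain W0 c where W0U: "W0 \<in> carrier (U_group ?m)" and c: "col W0 0 = c \<cdot>\<^sub>v v"
    using exists_unitary_with_first_column[OF v] by auto
  then have W0: "W0 \<in> carrier_mat ?m ?m" and W0W0: "mat_adjoint W0 * W0 = 1\<^sub>m ?m"
    by (auto simp: carrier_U_group_iff)
  note W0' = mat_adjoint_carrier[OF W0]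
  define H' where "H' = mat_adjoint W0 * H * W0"
  have H': "H' \<in> carrier_mat ?m ?m" using H W0 W0' by (simp add: H'_def)
  have herm: "mat_adjoint H' = H'"
    using Suc.prems(2) mat_adjoint_mult3[OF W0' H W0] H W0 W0'
    by (simp add: H'_def hermitian_mat_def)
  have "col H' 0 = mat_adjoint W0 *\<^sub>v (H *\<^sub>v col W0 0)"
    unfolding H'_def assoc_mult_mat[OF W0' H W0]
    by (subst col_mult2[OF W0' mult_carrier_mat[OF H W0]], simp, subst col_mult2[OF H W0]) simp_all
  also have "H *\<^sub>v col W0 0 = e \<cdot>\<^sub>v col W0 0"
    using mult_mat_vec[OF H v(1)] ev by (simp add: c smult_smult_assoc mult.commute)
  also have "mat_adjoint W0 *\<^sub>v (e \<cdot>\<^sub>v col W0 0) = e \<cdot>\<^sub>v (mat_adjoint W0 *\<^sub>v col W0 0)"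
    by (rule mult_mat_vec[OF W0' carrier_vecI]) (use W0 in simp)
  also have "mat_adjoint W0 *\<^sub>v col W0 0 = col (1\<^sub>m ?m) 0"
    using col_mult2[OF W0' W0, of 0] W0W0 by simp
  finally have col0: "col H' 0 = e \<cdot>\<^sub>v col (1\<^sub>m ?m) 0" .
  have H'0: "H' $$ (i, 0) = (if i = 0 then e else 0)" if "i < ?m" for i
    using arg_cong[OF col0, of "\<lambda>w. w $ i"] that H' by simp
  have herm_index: "H' $$ (i, j) = cnj (H' $$ (j, i))" if "i < ?m" "j < ?m" for i j
    using that H' herm mat_adjoint_index[of i H' j] by simp
  define K where "K = mat n n (\<lambda>(i, j). H' $$ (Suc i, Suc j))"
  have K: "K \<in> carrier_mat n n" by (simp add: K_def)
  have "hermitian_mat K"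
    unfolding hermitian_mat_def
    by (rule eq_matI) (auto simp: K_def mat_adjoint_index herm_index[symmetric])
  then obtain V b where VU: "V \<in> carrier (U_group n)"
    and diag: "mat_adjoint V * K * V = mat_diag n b"
    using Suc.IH[OF K] by auto
  then have V: "V \<in> carrier_mat n n" and VV: "mat_adjoint V * V = 1\<^sub>m n"
    by (auto simp: carrier_U_group_iff)
  define E where "E = mat_diag 1 (\<lambda>_. e)"
  have H'_block: "H' = four_block_mat E (0\<^sub>m 1 n) (0\<^sub>m n 1) K"
  proof (rule eq_matI)
    fix i j assume "i < dim_row (four_block_mat E (0\<^sub>m 1 n) (0\<^sub>m n 1) K)"
      "j < dim_col (four_block_mat E (0\<^sub>m 1 n) (0\<^sub>m n 1) K)"
    then have ij: "i < ?m" "j < ?m" by (auto simp: E_def mat_diag_def K_def)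
    have "H' $$ (0, j) = (if j = 0 then cnj e else 0)" using ij herm_index[of 0 j] H'0 by simp
    then show "H' $$ (i, j) = four_block_mat E (0\<^sub>m 1 n) (0\<^sub>m n 1) K $$ (i, j)"
      using ij H'0 by (cases i; cases j) (auto simp: E_def mat_diag_def K_def)
  qed (use H' in \<open>auto simp: E_def mat_diag_def K_def\<close>)
  define W1 where "W1 = four_block_mat (1\<^sub>m 1) (0\<^sub>m 1 n) (0\<^sub>m n 1) V"
  have W1adj: "mat_adjoint W1 = four_block_mat (1\<^sub>m 1) (0\<^sub>m 1 n) (0\<^sub>m n 1) (mat_adjoint V)"
    using mat_adjoint_four_block_diag[OF one_carrier_mat[of 1] V] by (simp add: W1_def)
  have W1: "W1 \<in> carrier_mat ?m ?m"
    using four_block_carrier_mat[OF one_carrier_mat[of 1] V] by (simp add: W1_def)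
  have V': "mat_adjoint V \<in> carrier_mat n n" and E: "E \<in> carrier_mat 1 1"
    using V by (auto simp: E_def mat_adjoint_carrier)
  have "mat_adjoint W1 * W1 = 1\<^sub>m ?m"
    unfolding W1adj unfolding W1_def
    using mult_four_block_diag[of "1\<^sub>m 1" 1 "mat_adjoint V" n "1\<^sub>m 1" V] V V' VV
    by simp
  then have W1U: "W1 \<in> carrier (U_group ?m)" using W1 by (simp add: carrier_U_group_iff)
  note W1' = mat_adjoint_carrier[OF W1]
  have "mat_adjoint W1 * H' * W1 =
      four_block_mat E (0\<^sub>m 1 n) (0\<^sub>m n 1) (mat_adjoint V * K * V)"
    unfolding W1adj H'_block unfolding W1_def
    using V V' K E mult_four_block_diag[of "1\<^sub>m 1" 1 "mat_adjoint V" n E K]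
      mult_four_block_diag[of "1\<^sub>m 1 * E" 1 "mat_adjoint V * K" n "1\<^sub>m 1" V]
    by simp
  also have "\<dots> = mat_diag ?m (case_nat e b)"
    unfolding diag
    by (rule eq_matI) (auto simp: E_def mat_diag_def split: nat.splits)
  finally have "mat_adjoint (W0 * W1) * H * (W0 * W1) = mat_diag ?m (case_nat e b)"
    using H W0 W0' W1 W1'
    by (simp add: H'_def mat_adjoint_mult[OF W0 W1] assoc_mult_mat[of _ ?m ?m _ ?m _ ?m])
  then show ?case using U_group_mult_closed[OF W0U W1U] by blast
qed


section \<open>The polar decomposition of an invertible matrix\<close>

text \<open>With \<open>W\<close> from the spectral theorem and \<open>X = g W\<close>, the diagonal matrix \<open>W* (g* g) W\<close> is
  \<open>X* X\<close>, whose entries are the squared norms of the columns of \<open>X\<close>. They are positive because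
  \<open>X\<close> is invertible and so has no zero column. Setting \<open>l\<close> to 1 beyond the size of the matrix
  makes it positive everywhere.\<close>

lemma adjoint_mult_diagonalizable:
  assumes g: "g \<in> carrier (GL_group m)"
  shows "\<exists>W \<in> carrier (U_group m). \<exists>l :: nat \<Rightarrow> real.
    (\<forall>i. l i > 0) \<and> mat_adjoint g * g = W * mat_diag m (\<lambda>i. of_real (l i)) * mat_adjoint W"
proof -
  obtain h where gm: "g \<in> carrier_mat m m" and hm: "h \<in> carrier_mat m m" and hg: "h * g = 1\<^sub>m m"
    using g by (auto simp: carrier_GL_group_iff)
  note gm' = mat_adjoint_carrier[OF gm]
  define H where "H = mat_adjoint g * g"
  have H: "H \<in> carrier_mat m m" using gm gm' by (simp add: H_def)
  have "hermitian_mat H" using mat_adjoint_mult[OF gm' gm] by (simp add: H_def hermitian_mat_def)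
  then obtain W a where WU: "W \<in> carrier (U_group m)"
    and a: "mat_adjoint W * H * W = mat_diag m a"
    using hermitian_unitarily_diagonalizable[OF H] by auto
  have W: "W \<in> carrier_mat m m" and WW: "mat_adjoint W * W = 1\<^sub>m m"
    and WW': "W * mat_adjoint W = 1\<^sub>m m"
    using WU U_group_mult_adjoint[OF WU] by (auto simp: carrier_U_group_iff)
  note W' = mat_adjoint_carrier[OF W]
  define X where "X = g * W"
  have X: "X \<in> carrier_mat m m" using gm W by (simp add: X_def)
  have XX: "mat_adjoint X * X = mat_diag m a"
    using gm gm' W W' a
    by (simp add: X_def H_def mat_adjoint_mult[OF gm W] assoc_mult_mat[of _ m m _ m _ m])
  obtain Y where Y: "Y \<in> carrier_mat m m" and left_inv: "Y * X = 1\<^sub>m m"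
  proof
    show "mat_adjoint W * h \<in> carrier_mat m m" using W' hm by (rule mult_carrier_mat)
    have "(mat_adjoint W * h) * X = mat_adjoint W * (h * g) * W"
      using gm hm W W' by (simp add: X_def assoc_mult_mat[of _ m m _ m _ m])
    then show "(mat_adjoint W * h) * X = 1\<^sub>m m" using hg W W' WW by simp
  qed
  define l where "l i = (if i < m then \<Sum>k<m. (cmod (X $$ (k, i)))\<^sup>2 else 1)" for i
  have a_eq: "a i = of_real (l i)" if i: "i < m" for i
  proof -
    have "a i = (mat_adjoint X * X) $$ (i, i)" using i by (simp add: XX mat_diag_def)
    also have "\<dots> = (\<Sum>k<m. cnj (X $$ (k, i)) * X $$ (k, i))"
      using X i by (simp add: scalar_prod_def mat_adjoint_index atLeast0LessThan)
    also have "\<dots> = (\<Sum>k<m. of_real ((cmod (X $$ (k, i)))\<^sup>2))"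
      by (rule sum.cong) (auto simp: complex_norm_square mult.commute simp del: of_real_power)
    finally show ?thesis using i by (simp add: l_def)
  qed
  have "l i > 0" for i
  proof (cases "i < m")
    case i: True
    have "l i \<noteq> 0"
    proof
      assume "l i = 0"
      then have "\<forall>k<m. X $$ (k, i) = 0"
        using i by (auto simp: l_def sum_nonneg_eq_0_iff)
      then have "(Y * X) $$ (i, i) = 0"
        using X Y i by (simp add: scalar_prod_def)
      then show False using left_inv i by simp
    qed
    moreover have "l i \<ge> 0" by (auto simp: l_def intro: sum_nonneg)
    ultimately show ?thesis by simp
  qed (simp add: l_def)
  moreover have "H = W * mat_diag m (\<lambda>i. of_real (l i)) * mat_adjoint W"
  proof -
    have "mat_diag m (\<lambda>i. of_real (l i)) = mat_diag m a"
      by (rule eq_matI) (auto simp: mat_diag_def a_eq)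
    then have "W * mat_diag m (\<lambda>i. of_real (l i)) * mat_adjoint W =
        (W * mat_adjoint W) * H * (W * mat_adjoint W)"
      using W W' H by (simp add: a[symmetric] assoc_mult_mat[of _ m m _ m _ m])
    then show ?thesis using WW' H by simp
  qed
  ultimately show ?thesis using WU by (auto simp: H_def)
qed

text \<open>The matrix multiplied to \<open>g\<close> is the inverse square root \<open>q\<close> of \<open>g* g\<close>, the inverse of the
  positive factor in the polar decomposition. It is Hermitian, so
  \<open>(g q)* (g q) = q (g* g) q = 1\<close>.\<close>

lemma polar_decomposition_unitary:
  fixes l :: "nat \<Rightarrow> real"
  assumes g: "g \<in> carrier_mat m m" and WU: "W \<in> carrier (U_group m)" and l: "\<And>i. l i > 0"
    and gg: "mat_adjoint g * g = W * mat_diag m (\<lambda>i. of_real (l i)) * mat_adjoint W"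
  shows "g * (W * mat_diag m (\<lambda>i. of_real (1 / sqrt (l i))) * mat_adjoint W) \<in> carrier (U_group m)"
proof -
  have W: "W \<in> carrier_mat m m" and WW: "mat_adjoint W * W = 1\<^sub>m m"
    and WW': "W * mat_adjoint W = 1\<^sub>m m"
    using WU U_group_mult_adjoint[OF WU] by (auto simp: carrier_U_group_iff)
  note W' = mat_adjoint_carrier[OF W]
  note g' = mat_adjoint_carrier[OF g]
  define L where "L = mat_diag m (\<lambda>i. complex_of_real (l i))"
  define S where "S = mat_diag m (\<lambda>i. complex_of_real (1 / sqrt (l i)))"
  define q where "q = W * S * mat_adjoint W"
  have L: "L \<in> carrier_mat m m" and S: "S \<in> carrier_mat m m" by (auto simp: L_def S_def)
  have q: "q \<in> carrier_mat m m" using W W' S by (simp add: q_def)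
  have q_herm: "mat_adjoint q = q"
    using mat_adjoint_mult3[OF W S W'] W W' S
    by (simp add: q_def S_def mat_adjoint_mat_diag)
  have "(1 / sqrt (l i)) * l i * (1 / sqrt (l i)) = 1" for i
    using l[of i] by (simp add: field_simps)
  then have SLS: "S * L * S = 1\<^sub>m m"
    unfolding S_def L_def mat_diag_diag of_real_mult[symmetric]
    by (auto intro!: eq_matI simp: mat_diag_def)
  have "mat_adjoint (g * q) * (g * q) = q * (mat_adjoint g * g) * q"
    using g g' q by (simp add: mat_adjoint_mult[OF g q] q_herm assoc_mult_mat[of _ m m _ m _ m])
  also have "\<dots> = W * S * (mat_adjoint W * W) * L * (mat_adjoint W * W) * S * mat_adjoint W"
    unfolding gg L_def[symmetric] q_def
    using W W' S L by (simp add: assoc_mult_mat[of _ m m _ m _ m] mult_carrier_mat[of _ m m])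
  also have "\<dots> = W * (S * L * S) * mat_adjoint W"
    using W W' S L by (simp add: WW assoc_mult_mat[of _ m m _ m _ m] mult_carrier_mat[of _ m m])
  also have "\<dots> = 1\<^sub>m m" using W W' by (simp add: SLS WW')
  finally show ?thesis
    using g q by (simp add: carrier_U_group_iff q_def[unfolded S_def])
qed

section \<open>Kronecker products of adjoints and of diagonal matrices\<close>

lemma mat_adjoint_kronecker:
  "mat_adjoint (kronecker A B) = kronecker (mat_adjoint A) (mat_adjoint B)"
proof (rule eq_matI)
  fix i j assume "i < dim_row (kronecker (mat_adjoint A) (mat_adjoint B))"
    "j < dim_col (kronecker (mat_adjoint A) (mat_adjoint B))"
  then have ij: "i < dim_col A * dim_col B" "j < dim_row A * dim_row B"
    by (auto simp: kronecker_def)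
  then have "dim_col B > 0" "dim_row B > 0" by (auto intro!: Nat.gr0I)
  then show "mat_adjoint (kronecker A B) $$ (i, j) =
      kronecker (mat_adjoint A) (mat_adjoint B) $$ (i, j)"
    using ij by (simp add: mat_adjoint_index kronecker_def less_mult_imp_div_less)
qed (auto simp: kronecker_def)

lemma mat_adjoint_tensor: "mat_adjoint (tensor n g) = tensor n (\<lambda>i. mat_adjoint (g i))"
  by (induction n) (auto simp: mat_adjoint_kronecker)

lemma kronecker_mat_diag:
  "kronecker (mat_diag a f) (mat_diag b g) = mat_diag (a * b) (\<lambda>k. f (k div b) * g (k mod b))"
proof (rule eq_matI)
  fix i j assume "i < dim_row (mat_diag (a * b) (\<lambda>k. f (k div b) * g (k mod b)))"
    "j < dim_col (mat_diag (a * b) (\<lambda>k. f (k div b) * g (k mod b)))"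
  then have ij: "i < a * b" "j < a * b" by (auto simp: mat_diag_def)
  then have "b > 0" by (auto intro!: Nat.gr0I)
  moreover have "i = j" if "i div b = j div b" "i mod b = j mod b"
    using that by (metis div_mult_mod_eq)
  ultimately show "kronecker (mat_diag a f) (mat_diag b g) $$ (i, j) =
      mat_diag (a * b) (\<lambda>k. f (k div b) * g (k mod b)) $$ (i, j)"
    using ij by (auto simp: kronecker_def mat_diag_def less_mult_imp_div_less)
qed (auto simp: kronecker_def mat_diag_def)

text \<open>The diagonal of a tensor product of diagonal matrices with diagonals \<open>l 0, \<dots>, l (n - 1)\<close>:
  the entry at \<open>k\<close> is the product of the \<open>l i\<close> at the mixed-radix digits of \<open>k\<close>.\<close>

primrec tensor_diag :: "nat \<Rightarrow> (nat \<Rightarrow> nat) \<Rightarrow> (nat \<Rightarrow> nat \<Rightarrow> real) \<Rightarrow> nat \<Rightarrow> real"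
  where
    "tensor_diag 0 d l = (\<lambda>k. 1)"
  | "tensor_diag (Suc n) d l = (\<lambda>k. tensor_diag n d l (k div d n) * l n (k mod d n))"

text \<open>Every eigenvalue of the tensor product is a product of eigenvalues of the factors. This is
  why a function applied to the eigenvalues of each factor has to be multiplicative in order to
  act on the eigenvalues of the product.\<close>

lemma tensor_mat_diag:
  fixes \<phi> :: "real \<Rightarrow> real"
  assumes "\<And>x y. \<phi> (x * y) = \<phi> x * \<phi> y" and "\<phi> 1 = 1"
  shows "tensor n (\<lambda>i. mat_diag (d i) (\<lambda>j. of_real (\<phi> (l i j)))) =
    mat_diag (tensor_dim n d) (\<lambda>k. of_real (\<phi> (tensor_diag n d l k)))"
proof (induction n)
  case 0
  show ?case by (rule eq_matI) (auto simp: tensor_dim_def mat_diag_def assms)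
next
  case (Suc n)
  then show ?case by (simp add: kronecker_mat_diag tensor_dim_def assms)
qed

lemma tensor_carrier_U_group:
  assumes "\<And>i. i < n \<Longrightarrow> W i \<in> carrier (U_group (d i))"
  shows "tensor n W \<in> carrier (U_group (tensor_dim n d))"
proof -
  have W: "W i \<in> carrier_mat (d i) (d i)" "mat_adjoint (W i) * W i = 1\<^sub>m (d i)" if "i < n" for i
    using assms[OF that] by (auto simp: carrier_U_group_iff)
  have "mat_adjoint (tensor n W) * tensor n W = tensor n (\<lambda>i. mat_adjoint (W i) * W i)"
    unfolding mat_adjoint_tensor by (rule tensor_mult) (use W mat_adjoint_carrier in blast)+
  also have "\<dots> = tensor n (\<lambda>i. 1\<^sub>m (d i))" by (rule tensor_cong) (use W in auto)
  finally show ?thesis using W tensor_carrier[of n W d] by (simp add: carrier_U_group_iff tensor_one)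
qed

lemma tensor_mult3:
  assumes "\<And>i. i < n \<Longrightarrow> f i \<in> carrier_mat (d i) (d i)"
    "\<And>i. i < n \<Longrightarrow> g i \<in> carrier_mat (d i) (d i)" "\<And>i. i < n \<Longrightarrow> h i \<in> carrier_mat (d i) (d i)"
  shows "tensor n f * tensor n g * tensor n h = tensor n (\<lambda>i. f i * g i * h i)"
proof -
  have "f i * g i \<in> carrier_mat (d i) (d i)" if "i < n" for i
    using assms(1,2)[OF that] by (rule mult_carrier_mat)
  then show ?thesis
    using tensor_mult[of n f d g] tensor_mult[of n "\<lambda>i. f i * g i" d h] assms by simp
qed

lemma tensor_conjugated_mat_diag:
  fixes \<phi> :: "real \<Rightarrow> real"
  assumes W: "\<And>i. i < n \<Longrightarrow> W i \<in> carrier_mat (d i) (d i)"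
    and \<phi>: "\<And>x y. \<phi> (x * y) = \<phi> x * \<phi> y" "\<phi> 1 = 1"
  shows "tensor n (\<lambda>i. W i * mat_diag (d i) (\<lambda>j. of_real (\<phi> (l i j))) * mat_adjoint (W i)) =
    tensor n W * mat_diag (tensor_dim n d) (\<lambda>k. of_real (\<phi> (tensor_diag n d l k))) *
      mat_adjoint (tensor n W)"
  unfolding mat_adjoint_tensor tensor_mat_diag[OF \<phi>, symmetric]
  by (rule tensor_mult3[symmetric]) (use W mat_adjoint_carrier in auto)

section \<open>Commuting with a function of a diagonalized matrix\<close>

text \<open>Commuting with a diagonal matrix means that the entry \<open>(i, j)\<close> vanishes unless the diagonal
  entries \<open>f i\<close> and \<open>f j\<close> agree. If \<open>h\<close> is a function of \<open>f\<close>, the condition for \<open>h\<close> is weaker.\<close>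

lemma commutes_mat_diag:
  fixes A :: "complex mat"
  assumes A: "A \<in> carrier_mat m m" and comm: "A * mat_diag m f = mat_diag m f * A"
    and h: "\<And>i j. f i = f j \<Longrightarrow> h i = h j"
  shows "A * mat_diag m h = mat_diag m h * A"
proof (rule eq_matI)
  fix i j assume "i < dim_row (mat_diag m h * A)" "j < dim_col (mat_diag m h * A)"
  then have ij: "i < m" "j < m" using A by (auto simp: mat_diag_def)
  have "(A * mat_diag m f) $$ (i, j) = (mat_diag m f * A) $$ (i, j)" using comm by simp
  then have "A $$ (i, j) * f j = f i * A $$ (i, j)"
    using ij by (simp add: mat_diag_mult_left[OF A] mat_diag_mult_right[OF A])
  then have "A $$ (i, j) = 0 \<or> f i = f j" by auto
  then show "(A * mat_diag m h) $$ (i, j) = (mat_diag m h * A) $$ (i, j)"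
    using ij h[of i j] by (auto simp: mat_diag_mult_left[OF A] mat_diag_mult_right[OF A])
qed (use A in \<open>auto simp: mat_diag_def\<close>)

text \<open>Conjugation by \<open>W\<close> is an automorphism of the matrix algebra, so it preserves commutation. This
  moves the question to the eigenbasis, where the previous lemma applies.\<close>

lemma commutes_unitary_conjugate:
  assumes A: "A \<in> carrier_mat m m" and D: "D \<in> carrier_mat m m" and WU: "W \<in> carrier (U_group m)"
  shows "A * (W * D * mat_adjoint W) = (W * D * mat_adjoint W) * A \<longleftrightarrow>
    (mat_adjoint W * A * W) * D = D * (mat_adjoint W * A * W)" (is "?L = ?R \<longleftrightarrow> ?L' = ?R'")
proof -
  have W: "W \<in> carrier_mat m m" and WW: "mat_adjoint W * W = 1\<^sub>m m"
    and WW': "W * mat_adjoint W = 1\<^sub>m m"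
    using WU U_group_mult_adjoint[OF WU] by (auto simp: carrier_U_group_iff)
  note c = A D W mat_adjoint_carrier[OF W] mult_carrier_mat[of _ m m _ m]
  note assoc = assoc_mult_mat[of _ m m _ m _ m]
  have WWx: "mat_adjoint W * (W * x) = x" "W * (mat_adjoint W * x) = x" if "x \<in> carrier_mat m m" for x
    using that c WW WW' by (simp_all flip: assoc)
  have "?L' = mat_adjoint W * ?L * W" "?R' = mat_adjoint W * ?R * W"
    "?L = W * ?L' * mat_adjoint W" "?R = W * ?R' * mat_adjoint W"
    using c by (simp_all add: assoc WWx WW WW')
  then show ?thesis by metis
qed

section \<open>From invertible to unitary intertwiners\<close>

lemma (in group_action) same_orbit_iff:
  assumes "x \<in> E" "y \<in> E"
  shows "(\<exists>X \<in> orbits G E \<phi>. x \<in> X \<and> y \<in> X) \<longleftrightarrow> (\<exists>g \<in> carrier G. \<phi> g x = y)"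
proof
  assume "\<exists>X \<in> orbits G E \<phi>. x \<in> X \<and> y \<in> X"
  then obtain z where z: "z \<in> E" "x \<in> orbit G \<phi> z" "y \<in> orbit G \<phi> z"
    by (auto simp: orbits_def)
  then have "y \<in> orbit G \<phi> x"
    using orbit_trans[of x z y] orbit_sym[of z x] assms by blast
  then show "\<exists>g \<in> carrier G. \<phi> g x = y" by (auto simp: orbit_def)
next
  assume "\<exists>g \<in> carrier G. \<phi> g x = y"
  then have "y \<in> orbit G \<phi> x" by (auto simp: orbit_def)
  then show "\<exists>X \<in> orbits G E \<phi>. x \<in> X \<and> y \<in> X"
    using orbit_refl assms by (auto simp: orbits_def)
qed

text \<open>The intertwining equation avoids the inverse of the tensor product, and can be handled by
  taking adjoints.\<close>

lemma conj_action_eq_iff: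
  assumes g: "g \<in> carrier (GL_tuple n d)" and A: "A \<in> End_tensor n d" and B: "B \<in> End_tensor n d"
  shows "conj_action n d g A = B \<longleftrightarrow> tensor n g * A = B * tensor n g"
proof -
  let ?N = "tensor_dim n d"
  let ?R = "ring_mat TYPE(complex) ?N ()"
  let ?T = "tensor n g"
  interpret R: ring ?R by (rule ring_mat)
  have T: "?T \<in> Units ?R"
    using hom_carrier[OF tensor_hom] g carrier_GL_group by blast
  have c: "?T \<in> carrier_mat ?N ?N" "inv\<^bsub>?R\<^esub> ?T \<in> carrier_mat ?N ?N"
    "A \<in> carrier_mat ?N ?N" "B \<in> carrier_mat ?N ?N"
    using R.Units_closed[OF T] R.Units_inv_closed[OF T] A B by (auto simp: ring_mat_def End_tensor_def)
  have inv: "?T * inv\<^bsub>?R\<^esub> ?T = 1\<^sub>m ?N" "inv\<^bsub>?R\<^esub> ?T * ?T = 1\<^sub>m ?N"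
    using R.Units_r_inv[OF T] R.Units_l_inv[OF T] by (auto simp: ring_mat_def)
  have "?T * A * inv\<^bsub>?R\<^esub> ?T * ?T = ?T * A" "B * ?T * inv\<^bsub>?R\<^esub> ?T = B"
    using c inv by (simp_all add: assoc_mult_mat[of _ ?N ?N _ ?N _ ?N])
  then show ?thesis using A by (auto simp: conj_action_def)
qed

text \<open>The unitary \<open>u\<close> is the tuple of the polar factors of the \<open>g i\<close>. In the proof, \<open>D h\<close>
  is the diagonal matrix of the values of \<open>h\<close> at the eigenvalues of \<open>T* T\<close>, and the tensor product
  of the \<open>W i\<close> is the change to the eigenbasis.\<close>

lemma unitary_intertwiner:
  assumes g: "g \<in> carrier (GL_tuple n d)" and A: "A \<in> End_tensor n d" and B: "B \<in> End_tensor n d"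
    and herm: "hermitian_mat A" "hermitian_mat B"
    and TA: "tensor n g * A = B * tensor n g"
  shows "\<exists>u \<in> carrier (U_tuple n d). tensor n u * A = B * tensor n u"
proof -
  let ?N = "tensor_dim n d"
  have gi: "g i \<in> carrier (GL_group (d i))" if "i < n" for i
    using g that by (auto simp: GL_tuple_def)
  then have gm: "g i \<in> carrier_mat (d i) (d i)" if "i < n" for i
    using that GL_group_carrier_mat by blast
  have "\<forall>i. \<exists>W l. i < n \<longrightarrow> W \<in> carrier (U_group (d i)) \<and> (\<forall>j. l j > 0) \<and>
      mat_adjoint (g i) * g i = W * mat_diag (d i) (\<lambda>j. of_real (l j :: real)) * mat_adjoint W"
    using adjoint_mult_diagonalizable[OF gi] by meson
  then obtain W l where W: "\<And>i. i < n \<Longrightarrow> W i \<in> carrier (U_group (d i))"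
    and l: "\<And>i j. i < n \<Longrightarrow> l i j > (0 :: real)"
    and gg: "\<And>i. i < n \<Longrightarrow> mat_adjoint (g i) * g i =
      W i * mat_diag (d i) (\<lambda>j. of_real (l i j)) * mat_adjoint (W i)"
    by metis
  have Wm: "W i \<in> carrier_mat (d i) (d i)" if "i < n" for i
    using W[OF that] by (simp add: carrier_U_group_iff)
  define q where "q i = W i * mat_diag (d i) (\<lambda>j. of_real (1 / sqrt (l i j))) * mat_adjoint (W i)" for i
  have qm: "q i \<in> carrier_mat (d i) (d i)" if "i < n" for i
    unfolding q_def by (intro mult_carrier_mat[of _ "d i" "d i"] Wm that mat_adjoint_carrier mat_diag_dim)
  define T where "T = tensor n g"
  define Q where "Q = tensor n q"
  define D where "D h = mat_diag ?N (\<lambda>k. complex_of_real (h (tensor_diag n d l k)))" for h :: "real \<Rightarrow> real"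
  have WU: "tensor n W \<in> carrier (U_group ?N)" using W by (rule tensor_carrier_U_group)
  then have WN: "tensor n W \<in> carrier_mat ?N ?N" by (simp add: carrier_U_group_iff)
  have TT: "mat_adjoint T * T = tensor n W * D (\<lambda>x. x) * mat_adjoint (tensor n W)"
  proof -
    have "mat_adjoint T * T = tensor n (\<lambda>i. mat_adjoint (g i) * g i)"
      unfolding T_def mat_adjoint_tensor by (rule tensor_mult) (use gm mat_adjoint_carrier in auto)
    also have "\<dots> = tensor n (\<lambda>i. W i * mat_diag (d i) (\<lambda>j. of_real (l i j)) * mat_adjoint (W i))"
      by (rule tensor_cong) (rule gg)
    also have "\<dots> = tensor n W * D (\<lambda>x. x) * mat_adjoint (tensor n W)"
      unfolding D_def by (rule tensor_conjugated_mat_diag[where \<phi> = "\<lambda>x. x"]) (use Wm in auto)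
    finally show ?thesis .
  qed
  have Q: "Q = tensor n W * D (\<lambda>x. 1 / sqrt x) * mat_adjoint (tensor n W)"
    unfolding Q_def q_def D_def
    by (rule tensor_conjugated_mat_diag[where \<phi> = "\<lambda>x. 1 / sqrt x"])
      (use Wm in \<open>auto simp: real_sqrt_mult\<close>)
  have Tm: "T \<in> carrier_mat ?N ?N" and Qm: "Q \<in> carrier_mat ?N ?N"
    using tensor_carrier[of n g d] tensor_carrier[of n q d] gm qm by (auto simp: T_def Q_def)
  have Am: "A \<in> carrier_mat ?N ?N" and Bm: "B \<in> carrier_mat ?N ?N"
    using A B by (auto simp: End_tensor_def)
  note T' = mat_adjoint_carrier[OF Tm]
  note assoc = assoc_mult_mat[of _ ?N ?N _ ?N _ ?N]
  \<comment> \<open>The adjoint of the intertwining equation; both Hermitian hypotheses enter here.\<close>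
  have "A * mat_adjoint T = mat_adjoint T * B"
    using arg_cong[OF TA, of mat_adjoint] herm mat_adjoint_mult[OF Tm Am] mat_adjoint_mult[OF Bm Tm]
    by (simp add: hermitian_mat_def T_def)
  then have "A * (mat_adjoint T * T) = mat_adjoint T * B * T"
    using Am Tm T' by (simp flip: assoc)
  also have "\<dots> = (mat_adjoint T * T) * A"
    using TA Am Bm Tm T' by (simp add: assoc T_def)
  finally have AD: "(mat_adjoint (tensor n W) * A * tensor n W) * D (\<lambda>x. x) =
      D (\<lambda>x. x) * (mat_adjoint (tensor n W) * A * tensor n W)"
    unfolding TT by (subst (asm) commutes_unitary_conjugate[OF Am _ WU]) (simp add: D_def)
  have AQ: "A * Q = Q * A"
    unfolding Q
  proof (subst commutes_unitary_conjugate[OF Am _ WU])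
    show "(mat_adjoint (tensor n W) * A * tensor n W) * D (\<lambda>x. 1 / sqrt x) =
      D (\<lambda>x. 1 / sqrt x) * (mat_adjoint (tensor n W) * A * tensor n W)"
      unfolding D_def
      by (rule commutes_mat_diag[OF _ AD[unfolded D_def]])
        (use Am WN mat_adjoint_carrier[OF WN] in auto)
  qed (simp add: D_def)
  define u where "u = (\<lambda>i\<in>{..<n}. g i * q i)"
  have "u \<in> carrier (U_tuple n d)"
    using polar_decomposition_unitary[OF gm W l gg]
    by (auto simp: U_tuple_def u_def q_def)
  moreover have "tensor n u = T * Q"
  proof -
    have "tensor n u = tensor n (\<lambda>i. g i * q i)" by (rule tensor_cong) (simp add: u_def)
    then show ?thesis using tensor_mult[of n g d q] gm qm by (simp add: T_def Q_def)
  qed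
  moreover have "T * Q * A = B * (T * Q)"
  proof -
    have "T * Q * A = T * A * Q" using Am Tm Qm AQ by (simp add: assoc)
    then show ?thesis using TA Bm Tm Qm by (simp add: assoc T_def)
  qed
  ultimately show ?thesis by metis
qed

theorem proposition1p4:
  fixes n :: nat and d :: "nat \<Rightarrow> nat" and A B :: "complex mat"
  assumes "\<And>i. i < n \<Longrightarrow> d i > 0"
    and "A \<in> End_tensor n d" and "B \<in> End_tensor n d"
    and "hermitian_mat A" and "hermitian_mat B"
  shows
    "(\<exists>X \<in> orbits (GL_tuple n d) (End_tensor n d) (conj_action n d). A \<in> X \<and> B \<in> X) \<longleftrightarrow>
     (\<exists>X \<in> orbits (U_tuple n d) (End_tensor n d) (conj_action n d). A \<in> X \<and> B \<in> X)"
proof -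
  note AB = assms(2,3)
  have U_GL: "carrier (U_tuple n d) \<subseteq> carrier (GL_tuple n d)"
    by (rule subgroup.subset[OF U_tuple_subgroup])
  have "(\<exists>g \<in> carrier (GL_tuple n d). conj_action n d g A = B) \<longleftrightarrow>
      (\<exists>u \<in> carrier (U_tuple n d). conj_action n d u A = B)"
  proof
    assume "\<exists>g \<in> carrier (GL_tuple n d). conj_action n d g A = B"
    then obtain g where g: "g \<in> carrier (GL_tuple n d)" "tensor n g * A = B * tensor n g"
      using conj_action_eq_iff AB by blast
    obtain u where "u \<in> carrier (U_tuple n d)" "tensor n u * A = B * tensor n u"
      using unitary_intertwiner[OF g(1) AB assms(4,5) g(2)] by blast
    then show "\<exists>u \<in> carrier (U_tuple n d). conj_action n d u A = B"
      using conj_action_eq_iff AB U_GL by blast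
  qed (use U_GL in blast)
  then show ?thesis
    by (simp add: group_action.same_orbit_iff[OF conj_action_group_action AB]
        group_action.same_orbit_iff[OF conj_action_U_group_action AB])
qed

end
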